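(* Let $H$ and $K$ be cancellative monoids, and assume that $H$ contains at least one element of infinite order. Then every isomorphism $f \colon \mathcal P_{\mathrm{fin},1}(H) \to \mathcal P_{\mathrm{fin},1}(K)$ is cardinality-preserving, that is, $|A| = |f(A)|$ for all $A \in \mathcal P_{\mathrm{fin},1}(H)$.
   Context: Monoids are written multiplicatively and are not assumed commutative; $1_H$ is the identity of $H$. A monoid is cancellative if left multiplication and right multiplication by each of its elements are injective. An element $a$ has infinite order if its powers $a^0, a^1, a^2, \ldots$ are pairwise distinct. For a monoid $H$, $\mathcal P_{\mathrm{fin},1}(H)$ is the monoid of all finite subsets of $H$ containing $1_H$, with operation the setwise product $XY := \{xy : x \in X,\ y \in Y\}$ and identity $\{1_H\}$. *)

theory Defs
  imports "HOL-Algebra.Divisibility" "HOL-Algebra.Coset"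
begin

definition Pfin1 :: "('a, 'c) monoid_scheme \<Rightarrow> 'a set monoid" where
  "Pfin1 H =
    \<lparr>carrier = {X. finite X \<and> X \<subseteq> carrier H \<and> \<one>\<^bsub>H\<^esub> \<in> X},
     mult = set_mult H,
     one = {\<one>\<^bsub>H\<^esub>}\<rparr>"

definition infinite_order :: "('a, 'c) monoid_scheme \<Rightarrow> 'a \<Rightarrow> bool" where
  "infinite_order H a \<longleftrightarrow> inj (\<lambda>n::nat. a [^]\<^bsub>H\<^esub> n)"

lemma set_mult_eq: "set_mult H X Y = {x \<otimes>\<^bsub>H\<^esub> y |x y. x \<in> X \<and> y \<in> Y}"
  by (auto simp: set_mult_def)

lemma monoid_Pfin1:
  assumes "monoid H"
  shows "monoid (Pfin1 H)"
proof -
  interpret monoid H by fact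
  show ?thesis
  proof (rule monoidI)
    fix X Y assume X: "X \<in> carrier (Pfin1 H)" and Y: "Y \<in> carrier (Pfin1 H)"
    have "set_mult H X Y = (\<lambda>(x, y). x \<otimes>\<^bsub>H\<^esub> y) ` (X \<times> Y)"
      by (auto simp: set_mult_def)
    moreover have "\<one>\<^bsub>H\<^esub> \<in> set_mult H X Y"
      using X Y by (force simp: Pfin1_def set_mult_def)
    moreover have "set_mult H X Y \<subseteq> carrier H"
      using X Y by (auto simp: Pfin1_def set_mult_def)
    ultimately show "X \<otimes>\<^bsub>Pfin1 H\<^esub> Y \<in> carrier (Pfin1 H)"
      using X Y by (simp add: Pfin1_def)
  next
    fix X Y Z
    assume "X \<in> carrier (Pfin1 H)" "Y \<in> carrier (Pfin1 H)" "Z \<in> carrier (Pfin1 H)"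
    then have *: "X \<subseteq> carrier H" "Y \<subseteq> carrier H" "Z \<subseteq> carrier H"
      by (simp_all add: Pfin1_def)
    have assoc: "(x \<otimes>\<^bsub>H\<^esub> y) \<otimes>\<^bsub>H\<^esub> z = x \<otimes>\<^bsub>H\<^esub> (y \<otimes>\<^bsub>H\<^esub> z)"
      if "x \<in> X" "y \<in> Y" "z \<in> Z" for x y z
      using that * by (intro m_assoc) auto
    have "set_mult H (set_mult H X Y) Z = (\<Union>x\<in>X. \<Union>y\<in>Y. \<Union>z\<in>Z. {(x \<otimes>\<^bsub>H\<^esub> y) \<otimes>\<^bsub>H\<^esub> z})"
      by (auto simp: set_mult_def)
    also have "\<dots> = (\<Union>x\<in>X. \<Union>y\<in>Y. \<Union>z\<in>Z. {x \<otimes>\<^bsub>H\<^esub> (y \<otimes>\<^bsub>H\<^esub> z)})"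
      by (simp add: assoc cong: SUP_cong)
    also have "\<dots> = set_mult H X (set_mult H Y Z)"
      by (auto simp: set_mult_def)
    finally show "X \<otimes>\<^bsub>Pfin1 H\<^esub> Y \<otimes>\<^bsub>Pfin1 H\<^esub> Z = X \<otimes>\<^bsub>Pfin1 H\<^esub> (Y \<otimes>\<^bsub>Pfin1 H\<^esub> Z)"
      by (simp add: Pfin1_def)
  next
    fix X assume "X \<in> carrier (Pfin1 H)"
    then have "X \<subseteq> carrier H" by (simp add: Pfin1_def)
    then show "\<one>\<^bsub>Pfin1 H\<^esub> \<otimes>\<^bsub>Pfin1 H\<^esub> X = X" "X \<otimes>\<^bsub>Pfin1 H\<^esub> \<one>\<^bsub>Pfin1 H\<^esub> = X"
      by (force simp: Pfin1_def set_mult_def)+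
  qed (simp add: Pfin1_def)
qed

end

theory Submission
  imports Defs
begin

text \<open>
  The idea is to recover the cardinality of \<open>A\<close> by counting the solutions \<open>Y\<close> of one equation,
  \<open>Y X = A X\<^sup>3\<close> with \<open>X = {1, a}\<close>, in the power monoid. An isomorphism \<open>f\<close> turns these solutions
  into the solutions of the same equation for \<open>f A\<close> and \<open>f X\<close>, so the two counts agree.

  Suppose that no positive power of \<open>a\<close> moves an element of \<open>A\<close> into \<open>A\<close>. Then
  \<open>A X\<^sup>3\<close> is a disjoint union of runs \<open>x, xa, xa\<^sup>2, xa\<^sup>3\<close>, one for each \<open>x \<in> A\<close>. A solution \<open>Y\<close> must
  contain \<open>x\<close> and \<open>xa\<^sup>2\<close>, cannot contain \<open>xa\<^sup>3\<close>, and is free to contain \<open>xa\<close> or not. So there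
  are exactly \<open>2\<close> to the power \<open>card A\<close> solutions (\<open>card_cubic_sols\<close>). An element \<open>a\<close>
  of infinite order need not satisfy the hypothesis, but all large enough powers of it do, because only
  finitely many of the elements \<open>x a\<^sup>m\<close> can lie in \<open>A\<close>.

  It remains to see that \<open>f {1, a\<^sup>k}\<close> has the same shape, with a generator that also moves \<open>f A\<close>
  off itself. The equation with \<open>A = {1}\<close> does the first part: for an arbitrary \<open>B\<close> it has at
  least \<open>card B\<close> solutions, namely \<open>B\<^sup>2\<close> and \<open>B\<^sup>2\<close> with any one \<open>u \<in> B\<close>, \<open>u \<noteq> 1\<close>, removed
  (\<open>card_le_cubic_sols\<close>), while for \<open>{1, a}\<close> it has exactly two. So \<open>f {1, a} = {1, b}\<close>, and \<open>b\<close>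
  has infinite order because the powers of \<open>{1, b}\<close> are distinct. The factorisation
  \<open>{1, a}\<^sup>2\<^sup>k = {1, a\<^sup>k} {1, a}\<^sup>k\<close> is carried over to \<open>K\<close> and forces
  \<open>f {1, a\<^sup>k} = {1, b\<^sup>k}\<close>. Now one \<open>k\<close> can be taken large enough for \<open>A\<close> and \<open>f A\<close> at once.
\<close>

section \<open>The equation and powers of two-element sets\<close>

text \<open>
  The exponent three is the smallest for which the count reveals the cardinality of \<open>A\<close>: in the situation of
  \<open>card_cubic_sols\<close>, exponent two would leave one solution only.
\<close>

definition cubic_sols :: "('a, 'c) monoid_scheme \<Rightarrow> 'a set \<Rightarrow> 'a set \<Rightarrow> 'a set set" where
  "cubic_sols G A X = {Y \<in> carrier (Pfin1 G). Y \<otimes>\<^bsub>Pfin1 G\<^esub> X = A \<otimes>\<^bsub>Pfin1 G\<^esub> X [^]\<^bsub>Pfin1 G\<^esub> (3::nat)}"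

definition moves_off :: "('a, 'c) monoid_scheme \<Rightarrow> 'a \<Rightarrow> 'a set \<Rightarrow> bool" where
  "moves_off G a A \<longleftrightarrow> (\<forall>x\<in>A. \<forall>t::nat. 0 < t \<longrightarrow> x \<otimes>\<^bsub>G\<^esub> a [^]\<^bsub>G\<^esub> t \<notin> A)"

lemma mem_Pfin1:
  "X \<in> carrier (Pfin1 G) \<longleftrightarrow> finite X \<and> X \<subseteq> carrier G \<and> \<one>\<^bsub>G\<^esub> \<in> X"
  by (simp add: Pfin1_def)

lemma mult_Pfin1: "X \<otimes>\<^bsub>Pfin1 G\<^esub> Y = (\<Union>x\<in>X. \<Union>y\<in>Y. {x \<otimes>\<^bsub>G\<^esub> y})"
  by (simp add: Pfin1_def set_mult_def)

lemma one_Pfin1: "\<one>\<^bsub>Pfin1 G\<^esub> = {\<one>\<^bsub>G\<^esub>}"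
  by (simp add: Pfin1_def)

context monoid
begin

lemma Pfin1_pair: "a \<in> carrier G \<Longrightarrow> {\<one>, a} \<in> carrier (Pfin1 G)"
  by (simp add: mem_Pfin1)

lemma mult_Pfin1_pair:
  assumes "Y \<subseteq> carrier G"
  shows "Y \<otimes>\<^bsub>Pfin1 G\<^esub> {\<one>, a} = Y \<union> (\<lambda>y. y \<otimes> a) ` Y"
  using assms by (force simp: mult_Pfin1)

lemma pow_Pfin1_pair:
  fixes n :: nat
  assumes a: "a \<in> carrier G"
  shows "{\<one>, a} [^]\<^bsub>Pfin1 G\<^esub> n = (\<lambda>i. a [^] i) ` {..n}"
proof (induction n)
  case 0
  then show ?case by (simp add: one_Pfin1 nat_pow_def)
next
  case (Suc n)
  interpret P: monoid "Pfin1 G" by (rule monoid_Pfin1) unfold_locales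
  have "{\<one>, a} [^]\<^bsub>Pfin1 G\<^esub> Suc n = (\<lambda>i. a [^] i) ` {..n} \<union> (\<lambda>y. y \<otimes> a) ` (\<lambda>i. a [^] i) ` {..n}"
    using a by (simp add: Suc mult_Pfin1_pair image_subset_iff)
  also have "(\<lambda>y. y \<otimes> a) ` (\<lambda>i. a [^] i) ` {..n} = (\<lambda>i. a [^] i) ` Suc ` {..n}"
    by (simp add: image_image)
  also have "(\<lambda>i. a [^] i) ` {..n} \<union> (\<lambda>i. a [^] i) ` Suc ` {..n} = (\<lambda>i. a [^] i) ` {..Suc n}"
  proof -
    have "{..n} \<union> Suc ` {..n} = {..Suc n}"
      by (auto simp: image_iff le_Suc_eq) 
    then show ?thesis by (metis image_Un)
  qed
  finally show ?case .
qed

end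

section \<open>Elements of infinite order\<close>

context monoid_cancel
begin

lemma infinite_order_imp_moves_off_one: "infinite_order G a \<Longrightarrow> a \<in> carrier G \<Longrightarrow> moves_off G a {\<one>}"
proof -
  assume "infinite_order G a" and a: "a \<in> carrier G"
  then have i: "inj (\<lambda>n::nat. a [^] n)" by (simp add: infinite_order_def)
  have "a [^] t \<noteq> \<one>" if "0 < t" for t :: nat
    using injD[OF i, of t 0] that by auto
  then show ?thesis using a by (simp add: moves_off_def)
qed

lemma finite_powers_into:
  assumes a: "a \<in> carrier G" "infinite_order G a" and A: "finite A" "A \<subseteq> carrier G"
  shows "finite {m::nat. \<exists>x\<in>A. x \<otimes> a [^] m \<in> A}"
proof -
  have "finite {m::nat. x \<otimes> a [^] m \<in> A}" if x: "x \<in> A" for x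
  proof -
    have "inj (\<lambda>m::nat. x \<otimes> a [^] m)"
    proof (rule injI)
      fix m n :: nat assume "x \<otimes> a [^] m = x \<otimes> a [^] n"
      then have "a [^] m = a [^] n"
        using l_cancel[of x "a [^] m" "a [^] n"] subsetD[OF A(2) x] a(1) by simp
      then show "m = n" using a(2) by (simp add: infinite_order_def inj_eq)
    qed
    from finite_vimageI[OF A(1) this] show ?thesis by (simp add: vimage_def)
  qed
  then have "finite (\<Union>x\<in>A. {m::nat. x \<otimes> a [^] m \<in> A})" using A by simp
  moreover have "{m::nat. \<exists>x\<in>A. x \<otimes> a [^] m \<in> A} = (\<Union>x\<in>A. {m::nat. x \<otimes> a [^] m \<in> A})"
    by auto
  ultimately show ?thesis by simp
qed

text \<open>
  This provides the freedom to serve two sets with the same exponent: a power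
  \<open>(a\<^sup>k)\<^sup>t\<close> with \<open>t > 0\<close> is a power \<open>a\<^sup>m\<close> with \<open>m \<ge> k\<close>, so it is enough to take \<open>k\<close> beyond the finitely
  many \<open>m\<close> for which \<open>a\<^sup>m\<close> sends some element of \<open>A\<close> into \<open>A\<close>.
\<close>

lemma eventually_moves_off:
  assumes "a \<in> carrier G" "infinite_order G a" "finite A" "A \<subseteq> carrier G"
  shows "\<exists>N. \<forall>k>N. moves_off G (a [^] (k::nat)) A"
proof -
  from finite_powers_into[OF assms] obtain N where
    N: "\<And>m x. x \<in> A \<Longrightarrow> x \<otimes> a [^] (m::nat) \<in> A \<Longrightarrow> m \<le> N"
    unfolding finite_nat_set_iff_bounded_le by blast
  have "moves_off G (a [^] k) A" if "N < k" for k :: nat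
    unfolding moves_off_def
  proof (intro ballI allI impI notI)
    fix x t assume x: "x \<in> A" and t: "0 < (t::nat)" "x \<otimes> (a [^] k) [^] t \<in> A"
    then have "k * t \<le> N" using N[OF x, of "k * t"] assms(1) by (simp add: nat_pow_pow)
    with t that show False by (cases t) auto
  qed
  then show ?thesis by blast
qed

text \<open>
  Cancelling the smaller power of \<open>a\<close> on the right turns a coincidence between two runs into
  a positive power of \<open>a\<close> that takes an element of \<open>A\<close> back into \<open>A\<close>.
\<close>

lemma moves_off_no_return:
  assumes "moves_off G a A" "a \<in> carrier G" "A \<subseteq> carrier G" "x \<in> A" "y \<in> A"
    and "x \<otimes> a [^] (i::nat) = y \<otimes> a [^] (j::nat)"
  shows "i = j \<and> x = y"
proof -
  have *: "\<not> i' < j'" if "u \<in> A" "v \<in> A" "u \<otimes> a [^] i' = v \<otimes> a [^] j'"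
    for u v and i' j' :: nat
  proof
    assume l: "i' < j'"
    have c: "u \<in> carrier G" "v \<in> carrier G" using that assms(3) by auto
    have "u \<otimes> a [^] i' = (v \<otimes> a [^] (j' - i')) \<otimes> a [^] i'"
      using l c assms(2) that(3) by (simp add: m_assoc nat_pow_mult)
    then have "u = v \<otimes> a [^] (j' - i')"
      using c assms(2) r_cancel by (metis m_closed nat_pow_closed)
    then show False using l that(1,2) assms(1) by (auto simp: moves_off_def)
  qed
  have ij: "i = j" using *[of x y i j] *[of y x j i] assms by force
  with assms show ?thesis
    using r_cancel by (metis nat_pow_closed subsetD)
qed

section \<open>Counting the solutions of the cubic equation\<close>

text \<open>
  By the previous lemma, \<open>(x, i) \<mapsto> x a\<^sup>i\<close> is injective on \<open>A \<times> \<nat>\<close>, so the equation can be solved in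
  \<open>A \<times> \<nat>\<close>, where multiplication by \<open>{1, a}\<close> adds to a set its shift by one in the second coordinate.
  What has to be found are the \<open>S\<close> whose union with their shift is \<open>A \<times> {0, 1, 2, 3}\<close>. Row by
  row, \<open>0\<close> and \<open>2\<close> must belong to \<open>S\<close> (nothing else produces \<open>0\<close> and \<open>3\<close>, as \<open>3\<close> itself would
  produce \<open>4\<close>), and then \<open>1\<close> may be included or left out.
\<close>

lemma card_cubic_sols:
  assumes A: "A \<in> carrier (Pfin1 G)" and a: "a \<in> carrier G" and off: "moves_off G a A"
  shows "card (cubic_sols G A {\<one>, a}) = 2 ^ card A"
proof -
  have fin: "finite A" and sub: "A \<subseteq> carrier G" and one: "\<one> \<in> A"
    using A by (auto simp: mem_Pfin1)
  define r where "r = (\<lambda>(x, i::nat). x \<otimes> a [^] i)"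
  have inj: "inj_on r (A \<times> UNIV)"
    using moves_off_no_return[OF off a sub] by (auto simp: inj_on_def r_def)
  have r0: "r (x, 0) = x" if "x \<in> A" for x using that sub by (auto simp: r_def)
  have rS: "r (x, i) \<otimes> a = r (x, Suc i)" if "x \<in> A" for x i
    using that sub a by (simp add: r_def m_assoc subset_iff)
  have rc: "r p \<in> carrier G" if "p \<in> A \<times> UNIV" for p
    using that sub a by (auto simp: r_def)
  have cube: "A \<otimes>\<^bsub>Pfin1 G\<^esub> {\<one>, a} [^]\<^bsub>Pfin1 G\<^esub> (3::nat) = r ` (A \<times> {..3})"
    by (auto simp: pow_Pfin1_pair[OF a] mult_Pfin1 r_def)
  \<comment> \<open>\<open>T\<close> consists of the \<open>x\<close> whose optional member \<open>xa\<close> is taken\<close>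
  define F where "F = (\<lambda>T. r ` (A \<times> {0, 2} \<union> T \<times> {1::nat}))"
  have prod: "r ` S \<otimes>\<^bsub>Pfin1 G\<^esub> {\<one>, a} = r ` (S \<union> apsnd Suc ` S)" if "S \<subseteq> A \<times> UNIV" for S
  proof -
    have "(\<lambda>y. y \<otimes> a) ` r ` S = r ` apsnd Suc ` S"
      unfolding image_image using that by (intro image_cong refl) (auto simp: rS subset_iff)
    moreover have "r ` S \<subseteq> carrier G" using that rc by blast
    ultimately show ?thesis by (simp add: mult_Pfin1_pair image_Un)
  qed
  have "cubic_sols G A {\<one>, a} = F ` Pow A"
  proof (intro equalityI subsetI)
    fix Y assume "Y \<in> cubic_sols G A {\<one>, a}"
    then have Yc: "Y \<in> carrier (Pfin1 G)" and eq: "Y \<otimes>\<^bsub>Pfin1 G\<^esub> {\<one>, a} = r ` (A \<times> {..3})"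
      by (auto simp: cubic_sols_def cube)
    have "Y \<subseteq> r ` (A \<times> {..3})"
      using Yc by (subst eq[symmetric]) (simp add: mult_Pfin1_pair mem_Pfin1)
    then obtain S where S: "S \<subseteq> A \<times> {..3}" "Y = r ` S"
      by (meson subset_imageE)
    have subs: "S \<subseteq> A \<times> UNIV" "S \<union> apsnd Suc ` S \<subseteq> A \<times> UNIV" "A \<times> {..3::nat} \<subseteq> A \<times> UNIV"
      using S(1) by auto
    have "r ` (S \<union> apsnd Suc ` S) = r ` (A \<times> {..3})"
      using eq unfolding S(2) prod[OF subs(1)] .
    then have SS: "S \<union> apsnd Suc ` S = A \<times> {..3}"
      using inj_on_image_eq_iff[OF inj subs(2,3)] by simp
    have mem: "(x, i) \<in> S \<or> (\<exists>j. i = Suc j \<and> (x, j) \<in> S)" if "x \<in> A" "i \<le> 3" for x i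
    proof -
      have "(x, i) \<in> S \<union> apsnd Suc ` S" unfolding SS using that by simp
      then show ?thesis by force
    qed
    have mem': "Suc i \<le> 3" if "(x, i) \<in> S" for x i
    proof -
      have "(x, Suc i) \<in> S \<union> apsnd Suc ` S" using that by force
      then show ?thesis unfolding SS by simp
    qed
    define T where "T = {x. (x, 1) \<in> S}"
    have i2: "i \<le> 2" if "(x, i) \<in> S" for x i using mem'[OF that] by simp
    have m0: "(x, 0) \<in> S" if "x \<in> A" for x using mem[of x 0] that by simp
    have m2: "(x, 2) \<in> S" if "x \<in> A" for x
      using mem[of x 3] that i2[of x 3] by (auto simp: numeral_3_eq_3 numeral_2_eq_2)
    have "S = A \<times> {0, 2} \<union> T \<times> {1}"
    proof (intro equalityI subsetI)
      fix p assume p: "p \<in> S"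
      obtain x i where [simp]: "p = (x, i)" by fastforce
      have "x \<in> A" "i = 0 \<or> i = 1 \<or> i = 2" using p S i2[of x i] by auto
      then show "p \<in> A \<times> {0, 2} \<union> T \<times> {1}" using p by (auto simp: T_def)
    qed (auto simp: T_def intro: m0 m2)
    moreover have "T \<subseteq> A" using S by (auto simp: T_def)
    ultimately show "Y \<in> F ` Pow A" using S by (auto simp: F_def)
  next
    fix Y assume "Y \<in> F ` Pow A"
    then obtain T where T: "T \<subseteq> A" "Y = r ` (A \<times> {0, 2} \<union> T \<times> {1})" by (auto simp: F_def)
    let ?S = "A \<times> {0, 2} \<union> T \<times> {1::nat}"
    have sub: "?S \<subseteq> A \<times> UNIV" using T by auto
    have "\<one> \<in> Y" unfolding T using r0[OF one] one by (metis UnI1 image_eqI insertI1 mem_Sigma_iff)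
    then have "Y \<in> carrier (Pfin1 G)"
      using T fin sub rc finite_subset[OF T(1) fin] by (auto simp: mem_Pfin1)
    moreover have "?S \<union> apsnd Suc ` ?S = A \<times> {..3}"
    proof -
      have "apsnd Suc ` ?S = A \<times> {1, 3} \<union> T \<times> {2}" by (force simp: image_iff)
      moreover have "{..3::nat} = {0,1,2,3}" by auto
      ultimately show ?thesis using T by auto
    qed
    ultimately show "Y \<in> cubic_sols G A {\<one>, a}"
      using T prod[OF sub] by (simp add: cubic_sols_def cube)
  qed
  moreover have "inj_on F (Pow A)"
  proof (rule inj_onI)
    fix T T' assume T: "T \<in> Pow A" "T' \<in> Pow A" and eq: "F T = F T'"
    \<comment> \<open>the entries in column \<open>1\<close> give back \<open>T\<close>\<close>
    have "A \<times> {0, 2} \<union> T \<times> {1} = A \<times> {0, 2} \<union> T' \<times> {1::nat}"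
      using eq T unfolding F_def by (subst (asm) inj_on_image_eq_iff[OF inj]) auto
    then have "(x, 1::nat) \<in> A \<times> {0, 2} \<union> T \<times> {1} \<longleftrightarrow> (x, 1::nat) \<in> A \<times> {0, 2} \<union> T' \<times> {1}" for x
      by simp
    then show "T = T'" by simp blast
  qed
  ultimately show ?thesis using fin by (simp add: card_image card_Pow)
qed

text \<open>
  Removing \<open>u \<noteq> 1\<close> from \<open>Q = B\<^sup>2\<close> does not change \<open>Q B\<close>, because every product \<open>u s\<close> with \<open>s \<in> B\<close> is
  obtained in another way: it is \<open>1 \<cdot> u\<close> if \<open>s = 1\<close>, and otherwise it is \<open>(u s) \<cdot> 1\<close>, where \<open>u s\<close> lies in
  \<open>Q\<close> and differs from \<open>u\<close> by left cancellation.
\<close>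

lemma card_le_cubic_sols:
  assumes B: "B \<in> carrier (Pfin1 G)" and fin: "finite (cubic_sols G {\<one>} B)"
  shows "card B \<le> card (cubic_sols G {\<one>} B)"
proof -
  interpret P: monoid "Pfin1 G" by (rule monoid_Pfin1) unfold_locales
  have one: "\<one> \<in> B" and Bc: "B \<subseteq> carrier G" using B by (auto simp: mem_Pfin1)
  define Q where "Q = B \<otimes>\<^bsub>Pfin1 G\<^esub> B"
  have Q: "Q \<in> carrier (Pfin1 G)" using B by (simp add: Q_def)
  then have Qc: "Q \<subseteq> carrier G" by (simp add: mem_Pfin1)
  have BQ: "B \<subseteq> Q" using one Bc by (force simp: Q_def mult_Pfin1)
  have cube: "{\<one>} \<otimes>\<^bsub>Pfin1 G\<^esub> B [^]\<^bsub>Pfin1 G\<^esub> (3::nat) = Q \<otimes>\<^bsub>Pfin1 G\<^esub> B"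
    using B by (simp add: one_Pfin1[symmetric] Q_def numeral_3_eq_3)
  have Qsol: "Q \<in> cubic_sols G {\<one>} B" using Q by (simp add: cubic_sols_def cube)
  have sol: "Q - {u} \<in> cubic_sols G {\<one>} B" if u: "u \<in> B - {\<one>}" for u
  proof -
    have uc: "u \<in> carrier G" using u Bc by auto
    have "Q \<otimes>\<^bsub>Pfin1 G\<^esub> B \<subseteq> (Q - {u}) \<otimes>\<^bsub>Pfin1 G\<^esub> B"
    proof
      fix w assume "w \<in> Q \<otimes>\<^bsub>Pfin1 G\<^esub> B"
      then obtain q s where w: "w = q \<otimes> s" "q \<in> Q" "s \<in> B" by (auto simp: mult_Pfin1)
      have sc: "s \<in> carrier G" using w Bc by auto
      consider "q \<noteq> u" | "q = u" "s = \<one>" | "q = u" "s \<noteq> \<one>" by blast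
      then show "w \<in> (Q - {u}) \<otimes>\<^bsub>Pfin1 G\<^esub> B"
      proof cases
        case 1
        then show ?thesis using w by (auto simp: mult_Pfin1)
      next
        case 2
        then have "w = \<one> \<otimes> u" using w uc by simp
        moreover have "\<one> \<in> Q - {u}" using u BQ one by auto
        ultimately show ?thesis using u unfolding mult_Pfin1 by blast
      next
        case 3
        then have "u \<otimes> s \<noteq> u" using l_cancel[of u s \<one>] uc sc by auto
        moreover have "u \<otimes> s \<in> Q" using u w by (auto simp: Q_def mult_Pfin1)
        moreover have "w = (u \<otimes> s) \<otimes> \<one>" using 3 w uc sc by simp
        ultimately show ?thesis using one unfolding mult_Pfin1 by blast
      qed
    qed
    moreover have "(Q - {u}) \<otimes>\<^bsub>Pfin1 G\<^esub> B \<subseteq> Q \<otimes>\<^bsub>Pfin1 G\<^esub> B" by (auto simp: mult_Pfin1)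
    moreover have "Q - {u} \<in> carrier (Pfin1 G)" using Q u by (auto simp: mem_Pfin1)
    ultimately show ?thesis by (auto simp: cubic_sols_def cube)
  qed
  \<comment> \<open>the element \<open>1\<close> of \<open>B\<close> stands for the solution \<open>Q\<close> itself\<close>
  have "inj_on (\<lambda>u. if u = \<one> then Q else Q - {u}) B"
    using BQ by (auto simp: inj_on_def split: if_splits)
  moreover have "(\<lambda>u. if u = \<one> then Q else Q - {u}) ` B \<subseteq> cubic_sols G {\<one>} B"
    using Qsol sol by auto
  ultimately show ?thesis using fin by (rule card_inj_on_le)
qed

end

section \<open>Transport along an isomorphism\<close>

text \<open>
  A homomorphism of monoids in the sense of \<^const>\<open>hom\<close> need not preserve the identity; here it does
  because \<open>f\<close> is onto.
\<close>

lemma iso_Pfin1_one: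
  assumes H: "monoid H" and K: "monoid K" and f: "f \<in> iso (Pfin1 H) (Pfin1 K)"
  shows "f {\<one>\<^bsub>H\<^esub>} = {\<one>\<^bsub>K\<^esub>}"
proof -
  interpret PH: monoid "Pfin1 H" by (rule monoid_Pfin1[OF H])
  interpret PK: monoid "Pfin1 K" by (rule monoid_Pfin1[OF K])
  have hom: "f \<in> hom (Pfin1 H) (Pfin1 K)"
    and bij: "bij_betw f (carrier (Pfin1 H)) (carrier (Pfin1 K))"
    using f by (auto simp: iso_def)
  obtain E where E: "E \<in> carrier (Pfin1 H)" "f E = \<one>\<^bsub>Pfin1 K\<^esub>"
    using bij PK.one_closed unfolding bij_betw_def by (metis imageE)
  have c: "f \<one>\<^bsub>Pfin1 H\<^esub> \<in> carrier (Pfin1 K)" using hom_in_carrier[OF hom PH.one_closed] .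
  have "f (\<one>\<^bsub>Pfin1 H\<^esub> \<otimes>\<^bsub>Pfin1 H\<^esub> E) = f \<one>\<^bsub>Pfin1 H\<^esub> \<otimes>\<^bsub>Pfin1 K\<^esub> f E"
    using hom_mult[OF hom PH.one_closed E(1)] .
  then have "f \<one>\<^bsub>Pfin1 H\<^esub> = \<one>\<^bsub>Pfin1 K\<^esub>" using E c by simp
  then show ?thesis by (simp add: one_Pfin1)
qed

lemma iso_Pfin1_pow:
  assumes H: "monoid H" and K: "monoid K" and f: "f \<in> iso (Pfin1 H) (Pfin1 K)"
    and X: "X \<in> carrier (Pfin1 H)"
  shows "f (X [^]\<^bsub>Pfin1 H\<^esub> (n::nat)) = f X [^]\<^bsub>Pfin1 K\<^esub> n"
proof (induction n)
  case 0
  then show ?case using iso_Pfin1_one[OF H K f] by (simp add: nat_pow_def one_Pfin1)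
next
  case (Suc n)
  interpret PH: monoid "Pfin1 H" by (rule monoid_Pfin1[OF H])
  have "f \<in> hom (Pfin1 H) (Pfin1 K)" using f by (simp add: iso_def)
  from hom_mult[OF this PH.nat_pow_closed[OF X] X] show ?case by (simp add: Suc)
qed

lemma iso_bij_cubic_sols:
  assumes H: "monoid H" and K: "monoid K" and f: "f \<in> iso (Pfin1 H) (Pfin1 K)"
    and A: "A \<in> carrier (Pfin1 H)" and X: "X \<in> carrier (Pfin1 H)"
  shows "bij_betw f (cubic_sols H A X) (cubic_sols K (f A) (f X))"
proof -
  interpret PH: monoid "Pfin1 H" by (rule monoid_Pfin1[OF H])
  interpret PK: monoid "Pfin1 K" by (rule monoid_Pfin1[OF K])
  have hom: "f \<in> hom (Pfin1 H) (Pfin1 K)" 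
    and bij: "bij_betw f (carrier (Pfin1 H)) (carrier (Pfin1 K))"
    using f by (auto simp: iso_def)
  have inj: "inj_on f (carrier (Pfin1 H))" using bij by (simp add: bij_betw_def)
  have pow: "f (X [^]\<^bsub>Pfin1 H\<^esub> (3::nat)) = f X [^]\<^bsub>Pfin1 K\<^esub> (3::nat)"
    by (rule iso_Pfin1_pow[OF H K f X])
  have iff: "Y \<in> cubic_sols H A X \<longleftrightarrow> f Y \<in> cubic_sols K (f A) (f X)"
    if Y: "Y \<in> carrier (Pfin1 H)" for Y
  proof -
    have "f Y \<otimes>\<^bsub>Pfin1 K\<^esub> f X = f (Y \<otimes>\<^bsub>Pfin1 H\<^esub> X)"
      using hom_mult[OF hom] Y X by simp
    moreover have "f A \<otimes>\<^bsub>Pfin1 K\<^esub> f X [^]\<^bsub>Pfin1 K\<^esub> (3::nat) = f (A \<otimes>\<^bsub>Pfin1 H\<^esub> X [^]\<^bsub>Pfin1 H\<^esub> (3::nat))"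
      using hom_mult[OF hom] A X pow by simp
    moreover have "f Y \<in> carrier (Pfin1 K)" using hom_in_carrier[OF hom Y] .
    ultimately show ?thesis
      using Y A X inj_on_eq_iff[OF inj] by (simp add: cubic_sols_def)
  qed
  show ?thesis
  proof (rule bij_betwI')
    show "f Y = f Z \<longleftrightarrow> Y = Z" if "Y \<in> cubic_sols H A X" "Z \<in> cubic_sols H A X" for Y Z
      using that inj_on_eq_iff[OF inj] by (simp add: cubic_sols_def)
    show "f Y \<in> cubic_sols K (f A) (f X)" if "Y \<in> cubic_sols H A X" for Y
      using that iff[of Y] by (auto simp: cubic_sols_def)
    show "\<exists>Y \<in> cubic_sols H A X. Z = f Y" if Z: "Z \<in> cubic_sols K (f A) (f X)" for Z
    proof -
      have "Z \<in> carrier (Pfin1 K)" using Z by (simp add: cubic_sols_def)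
      then obtain Y where "Y \<in> carrier (Pfin1 H)" "Z = f Y"
        using bij by (auto simp: bij_betw_def)
      then show ?thesis using iff Z by auto
    qed
  qed
qed

text \<open>
  Counting the solutions for \<open>A = {1}\<close> gives two on the side of \<open>H\<close>, hence at most two elements in
  \<open>f {1, a}\<close>. If two powers \<open>b\<^sup>i = b\<^sup>j\<close> with \<open>i < j\<close> were equal, then \<open>b\<^sup>j\<close> would add nothing to
  \<open>{1, b}\<close> to the power \<open>j - 1\<close>, so the powers \<open>j - 1\<close> and \<open>j\<close> of \<open>{1, b}\<close> would agree, and by
  injectivity of \<open>f\<close> so would those of \<open>{1, a}\<close>.
\<close>

lemma iso_pair:
  assumes H: "monoid_cancel H" and K: "monoid_cancel K" and f: "f \<in> iso (Pfin1 H) (Pfin1 K)"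
    and a: "a \<in> carrier H" "infinite_order H a"
  shows "\<exists>b \<in> carrier K. infinite_order K b \<and> f {\<one>\<^bsub>H\<^esub>, a} = {\<one>\<^bsub>K\<^esub>, b}"
proof -
  interpret H: monoid_cancel H by (rule H)
  interpret K: monoid_cancel K by (rule K)
  interpret PH: monoid "Pfin1 H" by (rule monoid_Pfin1) unfold_locales
  have mon: "monoid H" "monoid K" by unfold_locales
  have hom: "f \<in> hom (Pfin1 H) (Pfin1 K)"
    and inj: "inj_on f (carrier (Pfin1 H))"
    using f by (auto simp: iso_def bij_betw_def)
  note f_one = iso_Pfin1_one[OF mon f]
  define X where "X = {\<one>\<^bsub>H\<^esub>, a}"
  define B where "B = f X"
  have X: "X \<in> carrier (Pfin1 H)" unfolding X_def by (rule H.Pfin1_pair[OF a(1)])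
  have B: "B \<in> carrier (Pfin1 K)" unfolding B_def by (rule hom_in_carrier[OF hom X])
  have E: "{\<one>\<^bsub>H\<^esub>} \<in> carrier (Pfin1 H)" by (simp add: mem_Pfin1)
  have "card (cubic_sols H {\<one>\<^bsub>H\<^esub>} X) = 2"
    using H.card_cubic_sols[OF E a(1) H.infinite_order_imp_moves_off_one[OF a(2,1)]] by (simp add: X_def)
  moreover have "bij_betw f (cubic_sols H {\<one>\<^bsub>H\<^esub>} X) (cubic_sols K {\<one>\<^bsub>K\<^esub>} B)"
    using iso_bij_cubic_sols[OF mon f E X] by (simp add: f_one B_def)
  ultimately have "card (cubic_sols K {\<one>\<^bsub>K\<^esub>} B) = 2" using bij_betw_same_card by fastforce
  then have cB: "card B \<le> 2"
    using K.card_le_cubic_sols[OF B] by (simp add: card_ge_0_finite)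
  have finB: "finite B" and oneB: "\<one>\<^bsub>K\<^esub> \<in> B" and Bc: "B \<subseteq> carrier K"
    using B by (auto simp: mem_Pfin1)
  have "card (B - {\<one>\<^bsub>K\<^esub>}) \<le> 1" using cB finB oneB by simp
  then obtain b0 where "B - {\<one>\<^bsub>K\<^esub>} \<subseteq> {b0}"
    using finB by (metis card_1_singletonE card_0_eq finite_Diff le_Suc_eq One_nat_def le_zero_eq empty_subsetI order_refl)
  then have "B = {\<one>\<^bsub>K\<^esub>, if b0 \<in> B then b0 else \<one>\<^bsub>K\<^esub>}" using oneB by auto
  \<comment> \<open>\<open>B = {1}\<close> is covered by \<open>b = 1\<close> and is excluded below, since \<open>b\<close> has infinite order\<close>
  then obtain b where b: "B = {\<one>\<^bsub>K\<^esub>, b}" by blast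
  have bc: "b \<in> carrier K" using b Bc by auto
  have ne: "b [^]\<^bsub>K\<^esub> i \<noteq> b [^]\<^bsub>K\<^esub> j" if ij: "i < j" for i j :: nat
  proof
    assume eq: "b [^]\<^bsub>K\<^esub> i = b [^]\<^bsub>K\<^esub> j"
    obtain m where m: "j = Suc m" using ij by (cases j) auto
    have "b [^]\<^bsub>K\<^esub> j \<in> (\<lambda>i. b [^]\<^bsub>K\<^esub> i) ` {..m}" using ij m eq by (metis atMost_iff image_eqI less_Suc_eq_le)
    then have "B [^]\<^bsub>Pfin1 K\<^esub> j = B [^]\<^bsub>Pfin1 K\<^esub> m"
      unfolding b K.pow_Pfin1_pair[OF bc] m atMost_Suc by blast
    then have "f (X [^]\<^bsub>Pfin1 H\<^esub> j) = f (X [^]\<^bsub>Pfin1 H\<^esub> m)"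
      by (simp only: iso_Pfin1_pow[OF mon f X] B_def)
    then have "X [^]\<^bsub>Pfin1 H\<^esub> j = X [^]\<^bsub>Pfin1 H\<^esub> m"
      using inj X by (meson PH.nat_pow_closed inj_onD)
    then have "(\<lambda>i. a [^]\<^bsub>H\<^esub> i) ` {..j} = (\<lambda>i. a [^]\<^bsub>H\<^esub> i) ` {..m}"
      unfolding X_def H.pow_Pfin1_pair[OF a(1)] .
    then have "{..j} = {..m}"
      using a(2) unfolding infinite_order_def by (simp add: inj_image_eq_iff)
    then show False using m by simp
  qed
  then have "infinite_order K b"
    unfolding infinite_order_def by (metis injI linorder_neqE_nat)
  with b bc show ?thesis by (auto simp: B_def X_def)
qed

text \<open>
  Write \<open>f {1, a\<^sup>k} = {1, c}\<close>. The image of \<open>{1, a\<^sup>k} {1, a}\<^sup>k = {1, a}\<^sup>2\<^sup>k\<close> puts \<open>c = c \<cdot> 1\<close> among the powers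
  of \<open>b\<close>, say \<open>c = b\<^sup>j\<close>. Then \<open>c b\<^sup>k\<close> must not exceed \<open>b\<^sup>2\<^sup>k\<close>, so \<open>j \<le> k\<close>, and \<open>b\<^sup>2\<^sup>k\<close> must be reached by
  some \<open>c b\<^sup>i\<close> with \<open>i \<le> k\<close>, so \<open>j \<ge> k\<close>.
\<close>

lemma iso_pair_pow:
  fixes k :: nat
  assumes H: "monoid_cancel H" and K: "monoid_cancel K" and f: "f \<in> iso (Pfin1 H) (Pfin1 K)"
    and a: "a \<in> carrier H" "infinite_order H a"
    and b: "b \<in> carrier K" "infinite_order K b"
    and fa: "f {\<one>\<^bsub>H\<^esub>, a} = {\<one>\<^bsub>K\<^esub>, b}" and k: "0 < k"
  shows "f {\<one>\<^bsub>H\<^esub>, a [^]\<^bsub>H\<^esub> k} = {\<one>\<^bsub>K\<^esub>, b [^]\<^bsub>K\<^esub> k}"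
proof -
  interpret H: monoid_cancel H by (rule H)
  interpret K: monoid_cancel K by (rule K)
  interpret PH: monoid "Pfin1 H" by (rule monoid_Pfin1) unfold_locales
  have mon: "monoid H" "monoid K" by unfold_locales
  have hom: "f \<in> hom (Pfin1 H) (Pfin1 K)" using f by (simp add: iso_def)
  have ak: "a [^]\<^bsub>H\<^esub> k \<in> carrier H" using a by simp
  have "infinite_order H (a [^]\<^bsub>H\<^esub> k)"
    using a k by (simp add: infinite_order_def H.nat_pow_pow inj_def) (metis mult_cancel1 neq0_conv)
  then obtain c where c: "c \<in> carrier K" "f {\<one>\<^bsub>H\<^esub>, a [^]\<^bsub>H\<^esub> k} = {\<one>\<^bsub>K\<^esub>, c}"
    using iso_pair[OF H K f ak] by auto
  let ?X = "{\<one>\<^bsub>H\<^esub>, a}" and ?B = "{\<one>\<^bsub>K\<^esub>, b}"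
  have X: "?X \<in> carrier (Pfin1 H)" by (rule H.Pfin1_pair[OF a(1)])
  have split: "{..2 * k} = {..k} \<union> (\<lambda>i. k + i) ` {..k}"
  proof (intro equalityI subsetI)
    fix i assume i: "i \<in> {..2 * k}"
    show "i \<in> {..k} \<union> (\<lambda>i. k + i) ` {..k}"
    proof (cases "i \<le> k")
      case False
      then have "i = k + (i - k)" "i - k \<in> {..k}" using i by auto
      then show ?thesis by blast
    qed simp
  qed auto
  have "{\<one>\<^bsub>H\<^esub>, a [^]\<^bsub>H\<^esub> k} \<otimes>\<^bsub>Pfin1 H\<^esub> ?X [^]\<^bsub>Pfin1 H\<^esub> k = ?X [^]\<^bsub>Pfin1 H\<^esub> (2 * k)"
    unfolding H.pow_Pfin1_pair[OF a(1)] split image_Un image_image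
    using a(1) by (auto simp: mult_Pfin1 H.nat_pow_mult)
  from arg_cong[OF this, of f]
  have eq: "{\<one>\<^bsub>K\<^esub>, c} \<otimes>\<^bsub>Pfin1 K\<^esub> ?B [^]\<^bsub>Pfin1 K\<^esub> k = ?B [^]\<^bsub>Pfin1 K\<^esub> (2 * k)"
    using hom_mult[OF hom H.Pfin1_pair[OF ak] PH.nat_pow_closed[OF X, of k]]
    by (simp add: iso_Pfin1_pow[OF mon f X] fa c(2))
  have prod: "{\<one>\<^bsub>K\<^esub>, c} \<otimes>\<^bsub>Pfin1 K\<^esub> ?B [^]\<^bsub>Pfin1 K\<^esub> k
      = (\<lambda>i. b [^]\<^bsub>K\<^esub> i) ` {..k} \<union> (\<lambda>i. c \<otimes>\<^bsub>K\<^esub> b [^]\<^bsub>K\<^esub> i) ` {..k}"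
    unfolding K.pow_Pfin1_pair[OF b(1)] using b(1) by (auto simp: mult_Pfin1)
  have eq': "(\<lambda>i. b [^]\<^bsub>K\<^esub> i) ` {..k} \<union> (\<lambda>i. c \<otimes>\<^bsub>K\<^esub> b [^]\<^bsub>K\<^esub> i) ` {..k} = (\<lambda>i. b [^]\<^bsub>K\<^esub> i) ` {..2 * k}"
    by (rule eq[unfolded prod, unfolded K.pow_Pfin1_pair[OF b(1)]])
  have binj: "b [^]\<^bsub>K\<^esub> i = b [^]\<^bsub>K\<^esub> j \<longleftrightarrow> i = j" for i j :: nat
    using b(2) by (simp add: infinite_order_def inj_eq)
  have cm: "c \<otimes>\<^bsub>K\<^esub> b [^]\<^bsub>K\<^esub> i \<in> (\<lambda>i. b [^]\<^bsub>K\<^esub> i) ` {..2 * k}" if "i \<le> k" for i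
    unfolding eq'[symmetric] using that by blast
  obtain j where j: "c = b [^]\<^bsub>K\<^esub> (j::nat)" using cm[of 0] c(1) by auto
  have jm: "c \<otimes>\<^bsub>K\<^esub> b [^]\<^bsub>K\<^esub> i = b [^]\<^bsub>K\<^esub> (j + i)" for i :: nat
    using b(1) by (simp add: j K.nat_pow_mult)
  have "j \<le> k" using cm[of k] by (auto simp: jm binj)
  moreover have "b [^]\<^bsub>K\<^esub> (2 * k) \<in> (\<lambda>i. b [^]\<^bsub>K\<^esub> i) ` {..k} \<union> (\<lambda>i. c \<otimes>\<^bsub>K\<^esub> b [^]\<^bsub>K\<^esub> i) ` {..k}"
    unfolding eq' by blast
  then have "k \<le> j" using k by (auto simp: jm binj)
  ultimately show ?thesis using c j by simp
qed

section \<open>Isomorphisms preserve cardinality\<close>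

theorem proposition2p4:
  fixes H :: "('a, 'c) monoid_scheme" and K :: "('b, 'd) monoid_scheme"
    and f :: "'a set \<Rightarrow> 'b set"
  assumes "monoid_cancel H" and "monoid_cancel K"
    and "\<exists>a \<in> carrier H. infinite_order H a"
    and "f \<in> iso (Pfin1 H) (Pfin1 K)"
  shows "\<forall>A \<in> carrier (Pfin1 H). card A = card (f A)"
proof
  fix A assume A: "A \<in> carrier (Pfin1 H)"
  interpret H: monoid_cancel H by fact
  interpret K: monoid_cancel K by fact
  have mon: "monoid H" "monoid K" by unfold_locales
  note f = assms(4)
  have fA: "f A \<in> carrier (Pfin1 K)"
    using f A by (auto simp: iso_def intro: hom_in_carrier)
  obtain a where a: "a \<in> carrier H" "infinite_order H a" using assms(3) by blast
  obtain b where b: "b \<in> carrier K" "infinite_order K b" "f {\<one>\<^bsub>H\<^esub>, a} = {\<one>\<^bsub>K\<^esub>, b}"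
    using iso_pair[OF assms(1,2) f a] by blast
  obtain M N where M: "\<And>k::nat. M < k \<Longrightarrow> moves_off H (a [^]\<^bsub>H\<^esub> k) A"
    and N: "\<And>k::nat. N < k \<Longrightarrow> moves_off K (b [^]\<^bsub>K\<^esub> k) (f A)"
    using H.eventually_moves_off[OF a, of A] K.eventually_moves_off[OF b(1,2), of "f A"] A fA
    by (auto simp: mem_Pfin1)
  define k where "k = Suc (M + N)"
  have off: "moves_off H (a [^]\<^bsub>H\<^esub> k) A" "moves_off K (b [^]\<^bsub>K\<^esub> k) (f A)"
    using M[of k] N[of k] by (auto simp: k_def)
  have ak: "a [^]\<^bsub>H\<^esub> k \<in> carrier H" and bk: "b [^]\<^bsub>K\<^esub> k \<in> carrier K" using a b by auto
  have "f {\<one>\<^bsub>H\<^esub>, a [^]\<^bsub>H\<^esub> k} = {\<one>\<^bsub>K\<^esub>, b [^]\<^bsub>K\<^esub> k}"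
    by (rule iso_pair_pow[OF assms(1,2) f a b]) (simp add: k_def)
  with iso_bij_cubic_sols[OF mon f A H.Pfin1_pair[OF ak]]
  have "card (cubic_sols H A {\<one>\<^bsub>H\<^esub>, a [^]\<^bsub>H\<^esub> k}) = card (cubic_sols K (f A) {\<one>\<^bsub>K\<^esub>, b [^]\<^bsub>K\<^esub> k})"
    by (simp add: bij_betw_same_card)
  then have "(2::nat) ^ card A = 2 ^ card (f A)"
    by (simp add: H.card_cubic_sols[OF A ak off(1)] K.card_cubic_sols[OF fA bk off(2)])
  then show "card A = card (f A)" by simp
qed

end
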